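(* Let $n\ge2$, $m\ge1$, $1\le s\le n-1$, $r\in\mathbb{Z}/n\mathbb{Z}$, and let $D$ be a cylindric skew shape in $\mathcal{Q}_s=\mathbb{Z}^2/(n-s,s)\mathbb{Z}$. Then the cylindric loop Schur function $s_D^{(r)}(\mathtt{x}_1,\dots,\mathtt{x}_m)$ lies in the invariant subring $\mathbb{Q}[\mathtt{x}_i^{(j)}]^{S_m}$; that is, this polynomial is invariant under the birational action of $S_m$ on $\mathbb{Q}(\mathtt{x}_i^{(j)})$ generated by the birational $R$-matrices $\mathtt{R}_1,\dots,\mathtt{R}_{m-1}$.
   Context: Variables are $\mathtt{x}_j^{(i)}$ with $1\le j\le m$ and $i\in\mathbb{Z}/n\mathbb{Z}$ (upper indices modulo $n$); $\mathtt{x}_j=(\mathtt{x}_j^{(1)},\dots,\mathtt{x}_j^{(n)})$. **Birational $R$-matrix.** For two $n$-tuples $\mathtt{x}=(\mathtt{x}^{(1)},\dots,\mathtt{x}^{(n)})$, $\mathtt{y}=(\mathtt{y}^{(1)},\dots,\mathtt{y}^{(n)})$ and $r\in\mathbb{Z}/n\mathbb{Z}$ put $$\kappa_r(\mathtt{x},\mathtt{y})=\sum_{t=0}^{n-1}\ \prod_{u=1}^{t}\mathtt{y}^{(r+u)}\prod_{u=t+1}^{n-1}\mathtt{x}^{(r+u)}.$$ $\mathtt{R}$ is the rational map acting on $\mathbb{Q}(\mathtt{x}^{(1)},\dots,\mathtt{x}^{(n)},\mathtt{y}^{(1)},\dots,\mathtt{y}^{(n)})$ by $$\mathtt{R}(\mathtt{x}^{(i)})=\mathtt{y}^{(i+1)}\frac{\kappa_{i+1}(\mathtt{x},\mathtt{y})}{\kappa_i(\mathtt{x},\mathtt{y})},\qquad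 \mathtt{R}(\mathtt{y}^{(i)})=\mathtt{x}^{(i-1)}\frac{\kappa_{i-1}(\mathtt{x},\mathtt{y})}{\kappa_i(\mathtt{x},\mathtt{y})}.$$ For $1\le k\le m-1$, $\mathtt{R}_k$ acts on $\mathbb{Q}(\mathtt{x}_j^{(i)})$ by fixing the variables $\mathtt{x}_j$ with $j\ne k,k+1$ and applying $\mathtt{R}$ with $\mathtt{x}=\mathtt{x}_k$, $\mathtt{y}=\mathtt{x}_{k+1}$. It is known that the $\mathtt{R}_k$ generate an action of the symmetric group $S_m$ on $\mathbb{Q}(\mathtt{x}_j^{(i)})$. **Cylindric skew shapes.** $\mathcal{Q}_s=\mathbb{Z}^2/(n-s,s)\mathbb{Z}$ is the quotient of $\mathbb{Z}^2$ by the shift $(a,b)\mapsto(a+n-s,b+s)$. It carries the partial order that is the transitive closure of the relations $(a,b)<(a+1,b)$ and $(a,b)<(a,b-1)$. A cylindric skew shape is a finite convex subposet $D$ of $\mathcal{Q}_s$. The content of $(a,b)$ is $c(a,b)=-a-b$; it is well defined modulo $n$ on $\mathcal{Q}_s$. **Cylindric loop Schur functions.** A semistandard Young tableau of shape $D$ is a map $T:D\to\{1,\dots,m\}$ with $T(a,b)\le T(a+1,b)$ and $T(a,b)<T(a,b-1)$ whenever the corresponding boxes lie in $D$. Then $$s_D^{(r)}(\mathtt{x}_1,\dots,\mathtt{x}_m)=\sum_T\prod_{d\in D}\mathtt{x}_{T(d)}^{(c(d)+r)},$$ the sum over all semistandard Young tableaux $T$ of shape $D$; $s_D^{(r)}=1$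 if $D=\emptyset$. *)

theory Defs
  imports
    Complex_Main
    "HOL-Library.Poly_Mapping"
    "HOL-Library.Product_Lexorder"
    "HOL-Library.FuncSet"
    "HOL-Computational_Algebra.Fraction_Field"
begin

section \<open>Polynomials and rational functions over the rationals\<close>

text \<open>
  The pair \<open>(j, i)\<close> with \<open>1 \<le> j \<le> m\<close> and \<open>0 \<le> i < n\<close> stands for the variable with lower index
  \<open>j\<close> and upper index the residue class of \<open>i\<close>.  Other pairs are dummies, excluded by
  \<open>poly_ring\<close> below.  The lexicographic order on pairs is imported only because the library
  instance of class \<open>idom\<close> for polynomials needs linearly ordered indices.
\<close>

type_synonym poly_x = "((nat \<times> int) \<Rightarrow>\<^sub>0 nat) \<Rightarrow>\<^sub>0 rat"
type_synonym ratfun_x = "poly_x fract"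

definition var :: "nat \<Rightarrow> nat \<Rightarrow> int \<Rightarrow> poly_x" where
  "var n j i = Poly_Mapping.single (Poly_Mapping.single (j, i mod int n) 1) 1"

definition poly_ring :: "nat \<Rightarrow> nat \<Rightarrow> poly_x set" where
  "poly_ring n m =
     {f. \<forall>\<mu>\<in>Poly_Mapping.keys f. Poly_Mapping.keys \<mu> \<subseteq> {1..m} \<times> {0..<int n}}"

definition to_ratfun :: "poly_x \<Rightarrow> ratfun_x" where
  "to_ratfun f = Fract f 1"

definition subst_poly :: "(nat \<times> int \<Rightarrow> ratfun_x) \<Rightarrow> poly_x \<Rightarrow> ratfun_x" where
  "subst_poly \<sigma> f =
     (\<Sum>\<mu>\<in>Poly_Mapping.keys f. to_ratfun (Poly_Mapping.single 0 (Poly_Mapping.lookup f \<mu>)) *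
        (\<Prod>v\<in>Poly_Mapping.keys \<mu>. \<sigma> v ^ Poly_Mapping.lookup \<mu> v))"

text \<open>
  Substitution of rational functions into a rational function \<open>a / b\<close>.  The value does not
  depend on the chosen fraction as long as the substituted denominator is nonzero, see
  \<open>subst_ratfun_Fract\<close> below.
\<close>

definition subst_ratfun :: "(nat \<times> int \<Rightarrow> ratfun_x) \<Rightarrow> ratfun_x \<Rightarrow> ratfun_x" where
  "subst_ratfun \<sigma> q =
     (THE z. \<exists>a b. b \<noteq> 0 \<and> q = Fract a b \<and> subst_poly \<sigma> b \<noteq> 0 \<and>
        z = subst_poly \<sigma> a / subst_poly \<sigma> b)"


section \<open>The birational R-matrix and the action of the symmetric group\<close>

text \<open>Tuples indexed by residues modulo \<open>n\<close> are \<open>n\<close>-periodic functions on the integers.\<close>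

definition kappa :: "nat \<Rightarrow> int \<Rightarrow> (int \<Rightarrow> 'a::comm_ring_1) \<Rightarrow> (int \<Rightarrow> 'a) \<Rightarrow> 'a" where
  "kappa n r x y =
     (\<Sum>t = 0..n - 1. (\<Prod>u = 1..t. y (r + int u)) * (\<Prod>u = t + 1..n - 1. x (r + int u)))"

definition birational_R_fst ::
    "nat \<Rightarrow> (int \<Rightarrow> 'a::field) \<Rightarrow> (int \<Rightarrow> 'a) \<Rightarrow> int \<Rightarrow> 'a" where
  "birational_R_fst n x y i = y (i + 1) * (kappa n (i + 1) x y / kappa n i x y)"

definition birational_R_snd ::
    "nat \<Rightarrow> (int \<Rightarrow> 'a::field) \<Rightarrow> (int \<Rightarrow> 'a) \<Rightarrow> int \<Rightarrow> 'a" where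
  "birational_R_snd n x y i = x (i - 1) * (kappa n (i - 1) x y / kappa n i x y)"

definition R_images :: "nat \<Rightarrow> nat \<Rightarrow> nat \<times> int \<Rightarrow> ratfun_x" where
  "R_images n k = (\<lambda>(j, i).
     let x = (\<lambda>i. to_ratfun (var n k i)); y = (\<lambda>i. to_ratfun (var n (Suc k) i)) in
     if j = k then birational_R_fst n x y i
     else if j = Suc k then birational_R_snd n x y i
     else to_ratfun (var n j i))"

definition R_act :: "nat \<Rightarrow> nat \<Rightarrow> ratfun_x \<Rightarrow> ratfun_x" where
  "R_act n k = subst_ratfun (R_images n k)"

text \<open>
  The maps by which the elements of the symmetric group on \<open>m\<close> letters act: all products of
  \<open>R_act n 1, \<dots>, R_act n (m - 1)\<close>.  Inverses need not be added, as the generators are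
  involutions.
\<close>

inductive_set R_group :: "nat \<Rightarrow> nat \<Rightarrow> (ratfun_x \<Rightarrow> ratfun_x) set" for n m :: nat where
  id: "id \<in> R_group n m"
| step: "R_act n k \<circ> g \<in> R_group n m" if "g \<in> R_group n m" "1 \<le> k" "k \<le> m - 1"

definition invariant_ring :: "nat \<Rightarrow> nat \<Rightarrow> poly_x set" where
  "invariant_ring n m =
     {f \<in> poly_ring n m. \<forall>g\<in>R_group n m. g (to_ratfun f) = to_ratfun f}"


section \<open>Cylindric skew shapes and cylindric loop Schur functions\<close>

definition shift_rel :: "nat \<Rightarrow> nat \<Rightarrow> ((int \<times> int) \<times> (int \<times> int)) set" where
  "shift_rel n s =
     {((a, b), (a', b')) |a b a' b'. \<exists>k. a' = a + k * (int n - int s) \<and> b' = b + k * int s}"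

definition cylinder :: "nat \<Rightarrow> nat \<Rightarrow> (int \<times> int) set set" where
  "cylinder n s = UNIV // shift_rel n s"

definition box :: "nat \<Rightarrow> nat \<Rightarrow> int \<Rightarrow> int \<Rightarrow> (int \<times> int) set" where
  "box n s a b = shift_rel n s `` {(a, b)}"

definition cyl_less :: "nat \<Rightarrow> nat \<Rightarrow> ((int \<times> int) set \<times> (int \<times> int) set) set" where
  "cyl_less n s =
     ({(box n s a b, box n s (a + 1) b) |a b. True} \<union>
      {(box n s a b, box n s a (b - 1)) |a b. True})\<^sup>+"

definition cylindric_skew_shape :: "nat \<Rightarrow> nat \<Rightarrow> (int \<times> int) set set \<Rightarrow> bool" where
  "cylindric_skew_shape n s D \<longleftrightarrow>
     D \<subseteq> cylinder n s \<and> finite D \<and>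
     (\<forall>p\<in>D. \<forall>q\<in>D. \<forall>d\<in>cylinder n s. (p, d) \<in> cyl_less n s \<and> (d, q) \<in> cyl_less n s \<longrightarrow> d \<in> D)"

text \<open>The representative in \<open>{0..<n}\<close> of the content, which all points of a box share.\<close>

definition content_mod :: "nat \<Rightarrow> (int \<times> int) set \<Rightarrow> int" where
  "content_mod n d = the_elem ((\<lambda>(a, b). (- a - b) mod int n) ` d)"

definition tableaux ::
    "nat \<Rightarrow> nat \<Rightarrow> nat \<Rightarrow> (int \<times> int) set set \<Rightarrow> ((int \<times> int) set \<Rightarrow> nat) set" where
  "tableaux n s m D =
     {T \<in> D \<rightarrow>\<^sub>E {1..m}.
        (\<forall>a b. box n s a b \<in> D \<and> box n s (a + 1) b \<in> D \<longrightarrow>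
           T (box n s a b) \<le> T (box n s (a + 1) b)) \<and>
        (\<forall>a b. box n s a b \<in> D \<and> box n s a (b - 1) \<in> D \<longrightarrow>
           T (box n s a b) < T (box n s a (b - 1)))}"

definition cylindric_loop_schur ::
    "nat \<Rightarrow> nat \<Rightarrow> nat \<Rightarrow> int \<Rightarrow> (int \<times> int) set set \<Rightarrow> poly_x" where
  "cylindric_loop_schur n s m r D =
     (\<Sum>T\<in>tableaux n s m D. \<Prod>d\<in>D. var n (T d) (content_mod n d + r))"


section \<open>Well-definedness of the constructions above\<close>

lemma to_ratfun_simps [simp]:
  "to_ratfun 0 = 0" "to_ratfun 1 = 1"
  "to_ratfun (f + g) = to_ratfun f + to_ratfun g"
  "to_ratfun (f * g) = to_ratfun f * to_ratfun g"
  by (simp_all add: to_ratfun_def Zero_fract_def One_fract_def)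

definition subst_monom :: "(nat \<times> int \<Rightarrow> ratfun_x) \<Rightarrow> ((nat \<times> int) \<Rightarrow>\<^sub>0 nat) \<Rightarrow> ratfun_x" where
  "subst_monom \<sigma> \<mu> = (\<Prod>v\<in>Poly_Mapping.keys \<mu>. \<sigma> v ^ Poly_Mapping.lookup \<mu> v)"

lemma subst_monom_superset:
  assumes "finite A" "Poly_Mapping.keys \<mu> \<subseteq> A"
  shows "subst_monom \<sigma> \<mu> = (\<Prod>v\<in>A. \<sigma> v ^ Poly_Mapping.lookup \<mu> v)"
  unfolding subst_monom_def
  by (rule prod.mono_neutral_left) (use assms in \<open>auto simp: in_keys_iff\<close>)

lemma subst_monom_add: "subst_monom \<sigma> (\<mu> + \<nu>) = subst_monom \<sigma> \<mu> * subst_monom \<sigma> \<nu>"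
proof -
  let ?A = "Poly_Mapping.keys \<mu> \<union> Poly_Mapping.keys \<nu>"
  have "subst_monom \<sigma> \<rho> = (\<Prod>v\<in>?A. \<sigma> v ^ Poly_Mapping.lookup \<rho> v)"
    if "Poly_Mapping.keys \<rho> \<subseteq> ?A" for \<rho>
    using that by (intro subst_monom_superset) auto
  moreover have "Poly_Mapping.keys (\<mu> + \<nu>) \<subseteq> ?A"
    by (rule Poly_Mapping.keys_add)
  ultimately show ?thesis
    by (simp add: lookup_add power_add prod.distrib)
qed

lemma subst_poly_superset:
  assumes "finite A" "Poly_Mapping.keys f \<subseteq> A"
  shows "subst_poly \<sigma> f =
    (\<Sum>\<mu>\<in>A. to_ratfun (Poly_Mapping.single 0 (Poly_Mapping.lookup f \<mu>)) * subst_monom \<sigma> \<mu>)"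
  unfolding subst_poly_def subst_monom_def
  by (rule sum.mono_neutral_left) (use assms in \<open>auto simp: in_keys_iff\<close>)

lemma subst_poly_add: "subst_poly \<sigma> (f + g) = subst_poly \<sigma> f + subst_poly \<sigma> g"
proof -
  let ?A = "Poly_Mapping.keys f \<union> Poly_Mapping.keys g"
  have "subst_poly \<sigma> h =
      (\<Sum>\<mu>\<in>?A. to_ratfun (Poly_Mapping.single 0 (Poly_Mapping.lookup h \<mu>)) * subst_monom \<sigma> \<mu>)"
    if "Poly_Mapping.keys h \<subseteq> ?A" for h
    using that by (intro subst_poly_superset) auto
  moreover have "Poly_Mapping.keys (f + g) \<subseteq> ?A"
    by (rule Poly_Mapping.keys_add)
  ultimately show ?thesis
    by (simp add: lookup_add single_add sum.distrib distrib_right)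
qed

lemma subst_poly_zero [simp]: "subst_poly \<sigma> 0 = 0"
  by (simp add: subst_poly_def)

lemma subst_poly_single:
  "subst_poly \<sigma> (Poly_Mapping.single \<mu> c) =
     to_ratfun (Poly_Mapping.single 0 c) * subst_monom \<sigma> \<mu>"
  by (subst subst_poly_superset[of "{\<mu>}"]) auto

lemma subst_poly_one [simp]: "subst_poly \<sigma> 1 = 1"
  using subst_poly_single[of \<sigma> 0 1] by (simp add: subst_monom_def)

lemma subst_poly_single_mult:
  "subst_poly \<sigma> (Poly_Mapping.single \<mu> c * f) =
     subst_poly \<sigma> (Poly_Mapping.single \<mu> c) * subst_poly \<sigma> f"
proof (induction f rule: update_induct)
  case const
  then show ?case by simp
next
  case (update f a b)
  have [simp]: "Poly_Mapping.update a b f = Poly_Mapping.single a b + f"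
    using update(1) by (intro poly_mapping_eqI) (auto simp: lookup_update lookup_add lookup_single in_keys_iff)
  have "to_ratfun (Poly_Mapping.single 0 (c * b)) =
      to_ratfun (Poly_Mapping.single 0 c) * to_ratfun (Poly_Mapping.single 0 b)"
    unfolding to_ratfun_simps(4)[symmetric] by (simp add: mult_single)
  then show ?case
    using update(3)
    by (simp add: distrib_left subst_poly_add mult_single subst_poly_single subst_monom_add)
qed

lemma subst_poly_mult: "subst_poly \<sigma> (f * g) = subst_poly \<sigma> f * subst_poly \<sigma> g"
proof (induction f rule: update_induct)
  case const
  then show ?case by simp
next
  case (update f a b)
  have "Poly_Mapping.update a b f = Poly_Mapping.single a b + f"
    using update(1) by (intro poly_mapping_eqI) (auto simp: lookup_update lookup_add lookup_single in_keys_iff)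
  then show ?case
    using update(3) by (simp add: distrib_right subst_poly_add subst_poly_single_mult)
qed

lemma subst_ratfun_Fract:
  assumes "subst_poly \<sigma> b \<noteq> 0"
  shows "subst_ratfun \<sigma> (Fract a b) = subst_poly \<sigma> a / subst_poly \<sigma> b"
  unfolding subst_ratfun_def
proof (rule the_equality)
  have "b \<noteq> 0" using assms by auto
  then show "\<exists>c d. d \<noteq> 0 \<and> Fract a b = Fract c d \<and> subst_poly \<sigma> d \<noteq> 0 \<and>
      subst_poly \<sigma> a / subst_poly \<sigma> b = subst_poly \<sigma> c / subst_poly \<sigma> d"
    using assms by blast
  fix z
  assume "\<exists>c d. d \<noteq> 0 \<and> Fract a b = Fract c d \<and> subst_poly \<sigma> d \<noteq> 0 \<and>
      z = subst_poly \<sigma> c / subst_poly \<sigma> d"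
  then obtain c d where d: "d \<noteq> 0" "Fract a b = Fract c d" "subst_poly \<sigma> d \<noteq> 0"
      and z: "z = subst_poly \<sigma> c / subst_poly \<sigma> d" by blast
  have "a * d = c * b" using d \<open>b \<noteq> 0\<close> by (simp add: eq_fract)
  then have "subst_poly \<sigma> a * subst_poly \<sigma> d = subst_poly \<sigma> c * subst_poly \<sigma> b"
    by (metis subst_poly_mult)
  then show "z = subst_poly \<sigma> a / subst_poly \<sigma> b"
    using assms d(3) by (simp add: z field_simps)
qed

lemma subst_ratfun_to_ratfun: "subst_ratfun \<sigma> (to_ratfun f) = subst_poly \<sigma> f"
  using subst_ratfun_Fract[of \<sigma> 1 f] by (simp add: to_ratfun_def)

lemma shift_rel_iff:
  "(p, q) \<in> shift_rel n s \<longleftrightarrow>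
     (\<exists>k. fst q = fst p + k * (int n - int s) \<and> snd q = snd p + k * int s)"
  by (cases p; cases q) (simp add: shift_rel_def)

lemma equiv_shift_rel: "equiv UNIV (shift_rel n s)"
proof (rule equivI)
  show "refl (shift_rel n s)"
    by (auto simp: refl_on_def shift_rel_iff intro: exI[of _ 0])
  show "sym (shift_rel n s)"
  proof (rule symI)
    fix p q
    assume "(p, q) \<in> shift_rel n s"
    then obtain k where "fst q = fst p + k * (int n - int s)" "snd q = snd p + k * int s"
      unfolding shift_rel_iff by blast
    then have "fst p = fst q + (- k) * (int n - int s) \<and> snd p = snd q + (- k) * int s"
      by simp
    then show "(q, p) \<in> shift_rel n s"
      unfolding shift_rel_iff by blast
  qed
  show "trans (shift_rel n s)"
  proof (rule transI)
    fix p q t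
    assume "(p, q) \<in> shift_rel n s" "(q, t) \<in> shift_rel n s"
    then obtain k l where "fst q = fst p + k * (int n - int s)" "snd q = snd p + k * int s"
      "fst t = fst q + l * (int n - int s)" "snd t = snd q + l * int s"
      unfolding shift_rel_iff by blast
    then have "fst t = fst p + (k + l) * (int n - int s) \<and> snd t = snd p + (k + l) * int s"
      by (simp add: algebra_simps)
    then show "(p, t) \<in> shift_rel n s"
      unfolding shift_rel_iff by blast
  qed
qed simp

lemma content_mod_box: "content_mod n (box n s a b) = (- a - b) mod int n"
proof -
  have "(- (a + k * (int n - int s)) - (b + k * int s)) mod int n = (- a - b) mod int n" for k
  proof -
    have "- (a + k * (int n - int s)) - (b + k * int s) = (- a - b) + (- k) * int n"
      by (simp add: algebra_simps)
    then show ?thesis by (simp only: mod_mult_self1)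
  qed
  moreover have "(a, b) \<in> box n s a b"
    by (auto simp: box_def shift_rel_iff intro: exI[of _ 0])
  ultimately have "(\<lambda>(a, b). (- a - b) mod int n) ` box n s a b = {(- a - b) mod int n}"
    by (auto simp: box_def shift_rel_def image_iff; force)
  then show ?thesis by (simp add: content_mod_def)
qed

end

theory Submission
  imports Defs
begin

text \<open>
  Fix \<open>k\<close> and group the tableaux by the positions of all entries other than \<open>k\<close> and \<open>k + 1\<close>.
  Within a group, the boxes that carry \<open>k\<close> or \<open>k + 1\<close> have at most two boxes per column.  In a
  column with two of them the entries are forced, and they contribute
  \<open>x\<^sub>k\<^sup>(\<^sup>i\<^sup>) x\<^sub>k\<^sub>+\<^sub>1\<^sup>(\<^sup>i\<^sup>+\<^sup>1\<^sup>)\<close>.  The remaining boxes form horizontal chains, and the sum over the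
  weakly increasing fillings of a chain satisfies the recursion of a continuant in
  \<open>x\<^sub>k\<^sup>(\<^sup>i\<^sup>) + x\<^sub>k\<^sub>+\<^sub>1\<^sup>(\<^sup>i\<^sup>)\<close> and \<open>x\<^sub>k\<^sup>(\<^sup>i\<^sup>) x\<^sub>k\<^sub>+\<^sub>1\<^sup>(\<^sup>i\<^sup>+\<^sup>1\<^sup>)\<close>.  So everything is a polynomial in
  these two families and in the other variables, and the birational R-matrix preserves both
  families: the products because the factors \<open>\<kappa>\<close> cancel, the sums because
  \<open>y\<^sup>(\<^sup>i\<^sup>+\<^sup>1\<^sup>) \<kappa>\<^sub>i\<^sub>+\<^sub>1 - x\<^sup>(\<^sup>i\<^sup>) \<kappa>\<^sub>i\<close> does not depend on \<open>i\<close>.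
\<close>

section \<open>Two-valued fillings of chains\<close>

text \<open>A weakly increasing two-valued filling is encoded by the set of places of the larger value.\<close>

definition closed_subsets :: "('a \<Rightarrow> 'a) \<Rightarrow> 'a set \<Rightarrow> 'a set set" where
  "closed_subsets rt F = {A. A \<subseteq> F \<and> (\<forall>d\<in>A. rt d \<in> F \<longrightarrow> rt d \<in> A)}"

definition filling_weight :: "('a \<Rightarrow> 'b) \<Rightarrow> ('a \<Rightarrow> 'b) \<Rightarrow> 'a set \<Rightarrow> 'a set \<Rightarrow> 'b::comm_ring_1" where
  "filling_weight x y F A = (\<Prod>d\<in>F. if d \<in> A then y d else x d)"

definition chain_sum :: "('a \<Rightarrow> 'a) \<Rightarrow> ('a \<Rightarrow> 'b) \<Rightarrow> ('a \<Rightarrow> 'b) \<Rightarrow> 'a set \<Rightarrow> 'b::comm_ring_1" where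
  "chain_sum rt x y F = (\<Sum>A\<in>closed_subsets rt F. filling_weight x y F A)"

section \<open>Recursions for chain sums by removal of a last cell\<close>

lemma finite_closed_subsets: "finite F \<Longrightarrow> finite (closed_subsets rt F)"
  by (rule finite_subset[of _ "Pow F"]) (auto simp: closed_subsets_def)

lemma filling_weight_remove:
  assumes "finite F" "d \<in> F"
  shows "filling_weight x y F A = (if d \<in> A then y d else x d) * filling_weight x y (F - {d}) (A - {d})"
  unfolding filling_weight_def
  by (subst prod.remove[OF assms]) (auto intro!: prod.cong)

text \<open>If the last cell \<open>d\<close> of a chain carries the larger value, its left neighbor
  is unconstrained, so removing \<open>d\<close> is a bijection onto all closed subsets of the
  smaller set.\<close>

lemma sum_closed_subsets_member:
  assumes "finite F" "d \<in> F" "rt d \<notin> F"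
  shows "(\<Sum>A | A \<in> closed_subsets rt F \<and> d \<in> A. filling_weight x y F A) =
    y d * chain_sum rt x y (F - {d})"
  unfolding chain_sum_def sum_distrib_left
proof (rule sum.reindex_bij_witness[where i = "insert d" and j = "\<lambda>A. A - {d}"])
  fix A assume "A \<in> {A \<in> closed_subsets rt F. d \<in> A}"
  then show "y d * filling_weight x y (F - {d}) (A - {d}) = filling_weight x y F A"
    using filling_weight_remove[OF assms(1,2), of x y A] by simp
qed (use assms in \<open>auto simp: closed_subsets_def\<close>)

text \<open>If the last cell \<open>d\<close> carries the smaller value, so must a cell to its left;
  this is the surviving condition \<open>rt p \<noteq> d\<close>.\<close>

lemma sum_closed_subsets_nonmember:
  assumes "finite F" "d \<in> F" "rt d \<notin> F"
  shows "(\<Sum>A | A \<in> closed_subsets rt F \<and> d \<notin> A. filling_weight x y F A) =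
    x d * (\<Sum>A | A \<in> closed_subsets rt (F - {d}) \<and> (\<forall>p\<in>A. rt p \<noteq> d). filling_weight x y (F - {d}) A)"
  unfolding sum_distrib_left
proof (rule sum.cong)
  show "{A \<in> closed_subsets rt F. d \<notin> A} =
      {A \<in> closed_subsets rt (F - {d}). \<forall>p\<in>A. rt p \<noteq> d}"
    using assms by (auto simp: closed_subsets_def)
  fix A assume "A \<in> {A \<in> closed_subsets rt (F - {d}). \<forall>p\<in>A. rt p \<noteq> d}"
  then have "d \<notin> A" by (auto simp: closed_subsets_def)
  then show "filling_weight x y F A = x d * filling_weight x y (F - {d}) A"
    using filling_weight_remove[OF assms(1,2), of x y A] by simp
qed

lemma chain_sum_split:
  assumes "finite F"
  shows "chain_sum rt x y F = (\<Sum>A | A \<in> closed_subsets rt F \<and> P A. filling_weight x y F A) +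
    (\<Sum>A | A \<in> closed_subsets rt F \<and> \<not> P A. filling_weight x y F A)"
  unfolding chain_sum_def
  by (subst sum.union_disjoint[symmetric])
    (auto simp: finite_closed_subsets assms intro!: sum.cong)

lemma chain_sum_isolated:
  assumes "finite F" "d \<in> F" "rt d \<notin> F" "\<And>p. p \<in> F \<Longrightarrow> rt p \<noteq> d"
  shows "chain_sum rt x y F = (x d + y d) * chain_sum rt x y (F - {d})"
proof -
  have "{A \<in> closed_subsets rt (F - {d}). \<forall>p\<in>A. rt p \<noteq> d} = closed_subsets rt (F - {d})"
    using assms(4) by (auto simp: closed_subsets_def)
  then show ?thesis
    unfolding chain_sum_split[OF assms(1), where P = "\<lambda>A. d \<in> A"]
      sum_closed_subsets_member[of F d rt, OF assms(1-3)] sum_closed_subsets_nonmember[of F d rt, OF assms(1-3)]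
    by (simp add: chain_sum_def algebra_simps)
qed

text \<open>The continuant recursion. The first term lets the last cell \<open>rt p\<close> take
  both values independently of the rest; the second removes the fillings with the larger value at
  \<open>p\<close> and the smaller one at \<open>rt p\<close>. Injectivity makes \<open>p\<close>
  the only left neighbor of \<open>rt p\<close>.\<close>

lemma chain_sum_step:
  assumes "finite F" "p \<in> F" "rt p \<in> F" "rt (rt p) \<notin> F" "inj rt"
  shows "chain_sum rt x y F = (x (rt p) + y (rt p)) * chain_sum rt x y (F - {rt p}) -
    x (rt p) * y p * chain_sum rt x y (F - {rt p} - {p})"
proof -
  let ?F = "F - {rt p}"
  have ne: "rt p \<noteq> p" using assms by metis
  have "{A \<in> closed_subsets rt ?F. \<forall>q\<in>A. rt q \<noteq> rt p} = {A \<in> closed_subsets rt ?F. p \<notin> A}"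
    using assms(5) by (auto simp: inj_eq)
  moreover have "(\<Sum>A | A \<in> closed_subsets rt ?F \<and> p \<in> A. filling_weight x y ?F A) =
      y p * chain_sum rt x y (?F - {p})"
    by (rule sum_closed_subsets_member) (use assms ne in auto)
  moreover have "chain_sum rt x y ?F =
      (\<Sum>A | A \<in> closed_subsets rt ?F \<and> p \<in> A. filling_weight x y ?F A) +
      (\<Sum>A | A \<in> closed_subsets rt ?F \<and> p \<notin> A. filling_weight x y ?F A)"
    by (rule chain_sum_split) (use assms in auto)
  ultimately have *: "(\<Sum>A | A \<in> closed_subsets rt ?F \<and> (\<forall>q\<in>A. rt q \<noteq> rt p). filling_weight x y ?F A)
      = chain_sum rt x y ?F - y p * chain_sum rt x y (?F - {p})"
    by simp
  show ?thesis
    unfolding chain_sum_split[OF assms(1), where P = "\<lambda>A. rt p \<in> A"]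
      sum_closed_subsets_member[of F "rt p" rt, OF assms(1,3,4)]
      sum_closed_subsets_nonmember[of F "rt p" rt, OF assms(1,3,4)] *
    by (simp add: algebra_simps)
qed

text \<open>Acyclicity gives every nonempty subset a last cell, so the recursion for an isolated
  cell or the continuant recursion applies. Both see the weights only through
  \<open>x d + y d\<close> and \<open>x (rt d) * y d\<close>.\<close>

lemma chain_sum_cong:
  fixes x y x' y' :: "'a \<Rightarrow> 'b::comm_ring_1"
  assumes "finite F" "inj rt"
    and acyclic: "\<And>H. H \<subseteq> F \<Longrightarrow> H \<noteq> {} \<Longrightarrow> \<exists>d\<in>H. rt d \<notin> H"
    and add: "\<And>d. d \<in> F \<Longrightarrow> x d + y d = x' d + y' d"
    and mult: "\<And>d. d \<in> F \<Longrightarrow> rt d \<in> F \<Longrightarrow> x (rt d) * y d = x' (rt d) * y' d"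
  shows "chain_sum rt x y F = chain_sum rt x' y' F"
proof -
  have "chain_sum rt x y H = chain_sum rt x' y' H" if "H \<subseteq> F" for H
    using finite_subset[OF that assms(1)] that
  proof (induction H rule: finite_psubset_induct)
    case (psubset H)
    show ?case
    proof (cases "H = {}")
      case True
      then show ?thesis by (simp add: chain_sum_def closed_subsets_def filling_weight_def)
    next
      case False
      then obtain d where d: "d \<in> H" "rt d \<notin> H" using acyclic psubset.prems by blast
      have IH: "chain_sum rt x y (H - {d}) = chain_sum rt x' y' (H - {d})"
        "chain_sum rt x y (H - {d} - {p}) = chain_sum rt x' y' (H - {d} - {p})" for p
        by (rule psubset.IH; use d psubset.prems in blast)+
      show ?thesis
      proof (cases "\<exists>p\<in>H. rt p = d")
        case True
        then obtain p where p: "p \<in> H" "d = rt p" by blast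
        have "p \<in> F" "rt p \<in> F" using p d psubset.prems by auto
        then show ?thesis
          using chain_sum_step[of H p rt x y] chain_sum_step[of H p rt x' y'] IH(1) IH(2)[of p]
            add[of "rt p"] mult[of p] psubset.hyps p d \<open>inj rt\<close> by simp
      next
        case False
        have "d \<in> F" using d psubset.prems by auto
        then show ?thesis
          using chain_sum_isolated[of H d rt x y] chain_sum_isolated[of H d rt x' y'] IH(1)
            add[of d] psubset.hyps d False by auto
      qed
    qed
  qed
  then show ?thesis by simp
qed

section \<open>Tableaux and the exchange of two adjacent entries\<close>

text \<open>An abstract cylindric shape, with \<open>rt\<close> and \<open>up\<close> the directions
  of weak and strict increase. \<open>convex\<close> is convexity for the corners of a unit square;
  \<open>acyclic\<close> says that no row closes up inside \<open>D\<close>.\<close>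

locale cell_grid =
  fixes D :: "'a set" and rt up :: "'a \<Rightarrow> 'a" and m :: nat
  assumes finite_cells: "finite D"
    and inj_rt: "inj rt" and inj_up: "inj up"
    and up_rt: "up (rt d) = rt (up d)"
    and convex: "d \<in> D \<Longrightarrow> up (rt d) \<in> D \<Longrightarrow> up d \<in> D \<and> rt d \<in> D"
    and acyclic: "H \<subseteq> D \<Longrightarrow> H \<noteq> {} \<Longrightarrow> \<exists>d\<in>H. rt d \<notin> H"
begin

definition fillings :: "('a \<Rightarrow> nat) set" where
  "fillings = {T \<in> D \<rightarrow>\<^sub>E {1..m}.
     (\<forall>d. d \<in> D \<and> rt d \<in> D \<longrightarrow> T d \<le> T (rt d)) \<and> (\<forall>d. d \<in> D \<and> up d \<in> D \<longrightarrow> T d < T (up d))}"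

text \<open>Its fibers on \<open>fillings\<close> are the groups of tableaux that differ only in how
  \<open>k\<close> and \<open>Suc k\<close> are distributed.\<close>

definition collapse :: "nat \<Rightarrow> ('a \<Rightarrow> nat) \<Rightarrow> 'a \<Rightarrow> nat" where
  "collapse k T = (\<lambda>d. if T d = Suc k then k else T d)"

definition pair_cells :: "nat \<Rightarrow> ('a \<Rightarrow> nat) \<Rightarrow> 'a set" where
  "pair_cells k T = {d \<in> D. T d = k \<or> T d = Suc k}"

definition free_cells :: "nat \<Rightarrow> ('a \<Rightarrow> nat) \<Rightarrow> 'a set" where
  "free_cells k T = {d \<in> pair_cells k T. up d \<notin> pair_cells k T \<and> d \<notin> up ` pair_cells k T}"

definition refill :: "nat \<Rightarrow> ('a \<Rightarrow> nat) \<Rightarrow> 'a set \<Rightarrow> 'a \<Rightarrow> nat" where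
  "refill k T A = (\<lambda>d. if d \<in> free_cells k T then (if d \<in> A then Suc k else k) else T d)"

section \<open>Redistributing the two entries over the free cells\<close>

lemma finite_fillings: "finite fillings"
  by (rule finite_subset[of _ "D \<rightarrow>\<^sub>E {1..m}"])
    (auto simp: fillings_def finite_cells intro!: finite_PiE)

lemma fillings_rt: "T \<in> fillings \<Longrightarrow> d \<in> D \<Longrightarrow> rt d \<in> D \<Longrightarrow> T d \<le> T (rt d)"
  and fillings_up: "T \<in> fillings \<Longrightarrow> d \<in> D \<Longrightarrow> up d \<in> D \<Longrightarrow> T d < T (up d)"
  by (auto simp: fillings_def)

lemma lower_pair_cell:
  assumes "T \<in> fillings" "d \<in> pair_cells k T" "up d \<in> pair_cells k T"
  shows "T d = k" "T (up d) = Suc k"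
  using fillings_up[OF assms(1), of d] assms by (auto simp: pair_cells_def)

text \<open>Were the entry at \<open>rt d\<close> equal to \<open>k\<close>, this cell would be the
  lower one of a vertical pair. Convexity then puts \<open>up d\<close> in \<open>D\<close>, and
  monotonicity squeezes its entry to \<open>Suc k\<close>, so \<open>d\<close> would not be
  free.\<close>

lemma free_cells_left:
  assumes T: "T \<in> fillings" and d: "d \<in> free_cells k T" "rt d \<in> D" "rt d \<notin> free_cells k T"
  shows "Suc k \<le> T (rt d)"
proof (rule ccontr)
  assume "\<not> ?thesis"
  moreover have dE: "d \<in> D" "T d = k \<or> T d = Suc k" "up d \<notin> pair_cells k T"
    using d by (auto simp: free_cells_def pair_cells_def)
  ultimately have k: "T (rt d) = k" using fillings_rt[OF T, of d] d by linarith
  then have "rt d \<in> pair_cells k T" using d by (simp add: pair_cells_def)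
  then consider "up (rt d) \<in> pair_cells k T" | e where "e \<in> pair_cells k T" "rt d = up e"
    using d(3) by (auto simp: free_cells_def)
  then show False
  proof cases
    case 1
    then have u: "up d \<in> D" "rt (up d) \<in> D" "T (rt (up d)) = k \<or> T (rt (up d)) = Suc k"
      using convex[OF dE(1)] by (auto simp: pair_cells_def up_rt)
    then have "T d < T (up d)" "T (up d) \<le> T (rt (up d))"
      using fillings_up[OF T] fillings_rt[OF T] dE by auto
    then show False using u dE by (auto simp: pair_cells_def)
  next
    case 2
    then show False using fillings_up[OF T, of e] k d by (auto simp: pair_cells_def)
  qed
qed

text \<open>The mirror image: \<open>d\<close> would be the upper cell of a vertical pair, and the
  cell to the right of its lower partner \<open>e\<close> would be a pair cell directly below
  \<open>rt d\<close>.\<close>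

lemma free_cells_right:
  assumes T: "T \<in> fillings" and d: "d \<in> D" "rt d \<in> free_cells k T" "d \<notin> free_cells k T"
  shows "T d \<le> k"
proof (rule ccontr)
  assume "\<not> ?thesis"
  moreover have rE: "rt d \<in> D" "T (rt d) = k \<or> T (rt d) = Suc k" "rt d \<notin> up ` pair_cells k T"
    using d by (auto simp: free_cells_def pair_cells_def)
  ultimately have k: "T d = Suc k" using fillings_rt[OF T, of d] d by linarith
  then have "d \<in> pair_cells k T" using d by (simp add: pair_cells_def)
  then consider "up d \<in> pair_cells k T" | e where "e \<in> pair_cells k T" "d = up e"
    using d(3) by (auto simp: free_cells_def)
  then show False
  proof cases
    case 1
    then show False using fillings_up[OF T, of d] k d by (auto simp: pair_cells_def)
  next
    case 2
    then have e: "e \<in> D" "T e = k \<or> T e = Suc k" by (auto simp: pair_cells_def)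
    then have r: "rt e \<in> D" using convex[of e] rE 2 by (auto simp: up_rt)
    then have "T e \<le> T (rt e)" "T (rt e) < T (rt d)"
      using fillings_up[OF T, of "rt e"] fillings_rt[OF T] e rE 2 by (auto simp: up_rt)
    then have "rt e \<in> pair_cells k T" using r e rE by (auto simp: pair_cells_def)
    then show False using rE(3) 2 by (metis up_rt imageI)
  qed
qed

text \<open>Rows stay weakly increasing inside the free cells by closedness of \<open>A\<close>, and
  at their borders by the two preceding lemmas. Columns stay strict because the vertical neighbors
  of a free cell carry entries below \<open>k\<close> or above \<open>Suc k\<close>.\<close>

lemma refill_in_fillings:
  assumes T: "T \<in> fillings" and k: "1 \<le> k" "Suc k \<le> m"
    and A: "A \<in> closed_subsets rt (free_cells k T)"
  shows "refill k T A \<in> fillings"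
  unfolding fillings_def
proof (intro CollectI conjI allI impI)
  show "refill k T A \<in> D \<rightarrow>\<^sub>E {1..m}"
    using T k by (auto simp: fillings_def refill_def free_cells_def pair_cells_def PiE_iff extensional_def)
next
  fix d assume d: "d \<in> D \<and> rt d \<in> D"
  show "refill k T A d \<le> refill k T A (rt d)"
    using free_cells_left[OF T, of d k] free_cells_right[OF T, of d k] fillings_rt[OF T, of d] d A
    by (auto simp: refill_def closed_subsets_def)
next
  fix d assume d: "d \<in> D \<and> up d \<in> D"
  then have "T d < T (up d)" using fillings_up[OF T] by blast
  then show "refill k T A d < refill k T A (up d)"
    using d by (auto simp: refill_def free_cells_def pair_cells_def)
qed

lemma collapse_refill: "collapse k (refill k T A) = collapse k T"
  by (auto simp: fun_eq_iff collapse_def refill_def free_cells_def pair_cells_def)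

text \<open>Equal collapses have the same pair cells. Where such a cell has a vertical partner its
  entry is forced, so \<open>S\<close> and \<open>T\<close> can differ only on the free
  cells.\<close>

lemma refill_inverse:
  assumes T: "T \<in> fillings" "S \<in> fillings" and eq: "collapse k S = collapse k T"
  shows "refill k T {d \<in> free_cells k T. S d = Suc k} = S"
proof
  fix d
  have c: "(S e = k \<or> S e = Suc k) = (T e = k \<or> T e = Suc k)"
    "\<not> (T e = k \<or> T e = Suc k) \<Longrightarrow> S e = T e" for e
    using fun_cong[OF eq, of e] by (auto simp: collapse_def split: if_splits)
  have E: "pair_cells k S = pair_cells k T"
    using c(1) by (auto simp: pair_cells_def)
  consider "d \<in> free_cells k T" | "d \<notin> D" | "d \<in> D" "d \<notin> pair_cells k T"
    | "d \<in> pair_cells k T" "up d \<in> pair_cells k T"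
    | e where "e \<in> pair_cells k T" "up e \<in> pair_cells k T" "d = up e"
    by (auto simp: free_cells_def)
  then show "refill k T {d \<in> free_cells k T. S d = Suc k} d = S d"
  proof cases
    case 1
    then show ?thesis using c(1)[of d] by (auto simp: refill_def free_cells_def pair_cells_def)
  next
    case 2
    then show ?thesis using T
      by (auto simp: refill_def free_cells_def pair_cells_def fillings_def PiE_iff extensional_def)
  next
    case 3
    then show ?thesis using c(2)[of d] by (auto simp: refill_def free_cells_def pair_cells_def)
  next
    case 4
    then show ?thesis using lower_pair_cell(1)[OF T(1), of d k] lower_pair_cell(1)[OF T(2), of d k]
      by (simp add: refill_def free_cells_def E)
  next
    case 5
    then show ?thesis using lower_pair_cell(2)[OF T(1), of e k] lower_pair_cell(2)[OF T(2), of e k]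
      by (auto simp: refill_def free_cells_def E)
  qed
qed

section \<open>Weighted sums over the fibers of \<open>collapse\<close>\<close>

text \<open>For any representative \<open>T\<close> of the fiber, \<open>refill k T\<close> is a
  bijection from the closed subsets of the free cells onto the fiber.\<close>

lemma fiber_sum:
  fixes w :: "nat \<Rightarrow> 'a \<Rightarrow> 'b::comm_ring_1"
  assumes T: "T \<in> fillings" and k: "1 \<le> k" "Suc k \<le> m"
  shows "(\<Sum>S | S \<in> fillings \<and> collapse k S = collapse k T. \<Prod>d\<in>D. w (S d) d) =
    (\<Prod>d\<in>D - free_cells k T. w (T d) d) * chain_sum rt (w k) (w (Suc k)) (free_cells k T)"
proof -
  let ?F = "free_cells k T"
  have FD: "?F \<subseteq> D" by (auto simp: free_cells_def pair_cells_def)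
  have "(\<Prod>d\<in>D - ?F. w (T d) d) * chain_sum rt (w k) (w (Suc k)) ?F =
      (\<Sum>A\<in>closed_subsets rt ?F. \<Prod>d\<in>D. w (refill k T A d) d)"
    unfolding chain_sum_def sum_distrib_left
  proof (rule sum.cong[OF refl])
    fix A
    have "(\<Prod>d\<in>D. w (refill k T A d) d) =
        (\<Prod>d\<in>D - ?F. w (refill k T A d) d) * (\<Prod>d\<in>?F. w (refill k T A d) d)"
      by (rule prod.subset_diff[OF FD finite_cells])
    also have "\<dots> = (\<Prod>d\<in>D - ?F. w (T d) d) * filling_weight (w k) (w (Suc k)) ?F A"
      unfolding filling_weight_def
      by (intro arg_cong2[where f = "(*)"] prod.cong) (auto simp: refill_def)
    finally show "(\<Prod>d\<in>D - ?F. w (T d) d) * filling_weight (w k) (w (Suc k)) ?F A =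
        (\<Prod>d\<in>D. w (refill k T A d) d)" by simp
  qed
  also have "\<dots> = (\<Sum>S | S \<in> fillings \<and> collapse k S = collapse k T. \<Prod>d\<in>D. w (S d) d)"
  proof (rule sum.reindex_bij_witness[where j = "refill k T" and i = "\<lambda>S. {d \<in> ?F. S d = Suc k}"])
    fix S assume "S \<in> {S. S \<in> fillings \<and> collapse k S = collapse k T}"
    then have S: "S \<in> fillings" "collapse k S = collapse k T" by auto
    show "refill k T {d \<in> ?F. S d = Suc k} = S" by (rule refill_inverse[OF T S])
    have "S (rt d) = Suc k" if "d \<in> ?F" "rt d \<in> ?F" "S d = Suc k" for d
    proof -
      have "S d \<le> S (rt d)" using fillings_rt[OF S(1)] that FD by blast
      moreover have "S (rt d) = k \<or> S (rt d) = Suc k"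
        using fun_cong[OF S(2), of "rt d"] that
        by (auto simp: collapse_def free_cells_def pair_cells_def split: if_splits)
      ultimately show ?thesis using that by auto
    qed
    then show "{d \<in> ?F. S d = Suc k} \<in> closed_subsets rt ?F"
      by (auto simp: closed_subsets_def)
  next
    fix A assume A: "A \<in> closed_subsets rt ?F"
    then show "{d \<in> ?F. refill k T A d = Suc k} = A"
      by (auto simp: refill_def closed_subsets_def split: if_splits)
    show "refill k T A \<in> {S. S \<in> fillings \<and> collapse k S = collapse k T}"
      using refill_in_fillings[OF T k A] collapse_refill by blast
  qed simp
  finally show ?thesis by simp
qed

lemma prod_fixed_cells:
  fixes w :: "nat \<Rightarrow> 'a \<Rightarrow> 'b::comm_ring_1"
  assumes T: "T \<in> fillings"
  shows "(\<Prod>d\<in>D - free_cells k T. w (T d) d) = (\<Prod>d\<in>D - pair_cells k T. w (T d) d) *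
    (\<Prod>d | d \<in> pair_cells k T \<and> up d \<in> pair_cells k T. w k d * w (Suc k) (up d))"
proof -
  let ?E = "pair_cells k T" let ?P = "{d \<in> ?E. up d \<in> ?E}"
  have fin: "finite ?P" "finite ?E" using finite_cells by (auto simp: pair_cells_def)
  have "D - free_cells k T = (D - ?E) \<union> (?P \<union> up ` ?P)"
    by (auto simp: free_cells_def pair_cells_def)
  \<comment> \<open>A lower cell of a vertical pair carries \<open>k\<close>, an upper one
    \<open>Suc k\<close>, so no cell is both.\<close>
  moreover have disj: "?P \<inter> up ` ?P = {}"
    using lower_pair_cell[OF T] by fastforce
  moreover have "(D - ?E) \<inter> (?P \<union> up ` ?P) = {}" by auto
  ultimately have "(\<Prod>d\<in>D - free_cells k T. w (T d) d) = (\<Prod>d\<in>D - ?E. w (T d) d) *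
      ((\<Prod>d\<in>?P. w (T d) d) * (\<Prod>d\<in>up ` ?P. w (T d) d))"
    using fin finite_cells by (simp add: prod.union_disjoint)
  also have "(\<Prod>d\<in>up ` ?P. w (T d) d) = (\<Prod>d\<in>?P. w (Suc k) (up d))"
    using inj_up lower_pair_cell(2)[OF T]
    by (subst prod.reindex) (auto simp: inj_on_def inj_def intro!: prod.cong)
  also have "(\<Prod>d\<in>?P. w (T d) d) = (\<Prod>d\<in>?P. w k d)"
    using lower_pair_cell(1)[OF T] by (intro prod.cong) auto
  finally show ?thesis by (simp add: prod.distrib)
qed

text \<open>Each fiber sum depends on the weights of \<open>k\<close> and \<open>Suc k\<close> only
  through their sums on single cells and their products over horizontally or vertically adjacent
  cells.\<close>

lemma sum_fillings_cong:
  fixes w w' :: "nat \<Rightarrow> 'a \<Rightarrow> 'b::comm_ring_1"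
  assumes k: "1 \<le> k" "Suc k \<le> m"
    and other: "\<And>j d. d \<in> D \<Longrightarrow> j \<noteq> k \<Longrightarrow> j \<noteq> Suc k \<Longrightarrow> w j d = w' j d"
    and add: "\<And>d. d \<in> D \<Longrightarrow> w k d + w (Suc k) d = w' k d + w' (Suc k) d"
    and row: "\<And>d. d \<in> D \<Longrightarrow> w k (rt d) * w (Suc k) d = w' k (rt d) * w' (Suc k) d"
    and column: "\<And>d. d \<in> D \<Longrightarrow> w k d * w (Suc k) (up d) = w' k d * w' (Suc k) (up d)"
  shows "(\<Sum>T\<in>fillings. \<Prod>d\<in>D. w (T d) d) = (\<Sum>T\<in>fillings. \<Prod>d\<in>D. w' (T d) d)"
proof -
  have "(\<Sum>S | S \<in> fillings \<and> collapse k S = collapse k T. \<Prod>d\<in>D. w (S d) d) =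
      (\<Sum>S | S \<in> fillings \<and> collapse k S = collapse k T. \<Prod>d\<in>D. w' (S d) d)"
    if T: "T \<in> fillings" for T
  proof -
    have FD: "free_cells k T \<subseteq> D" by (auto simp: free_cells_def pair_cells_def)
    have "chain_sum rt (w k) (w (Suc k)) (free_cells k T) =
        chain_sum rt (w' k) (w' (Suc k)) (free_cells k T)"
    proof (rule chain_sum_cong[OF finite_subset[OF FD finite_cells] inj_rt])
      show "\<exists>d\<in>H. rt d \<notin> H" if "H \<subseteq> free_cells k T" "H \<noteq> {}" for H
        by (rule acyclic[OF order_trans[OF that(1) FD] that(2)])
    qed (use FD add row in auto)
    moreover have "(\<Prod>d\<in>D - pair_cells k T. w (T d) d) = (\<Prod>d\<in>D - pair_cells k T. w' (T d) d)"
      using other by (intro prod.cong) (auto simp: pair_cells_def)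
    moreover have "(\<Prod>d | d \<in> pair_cells k T \<and> up d \<in> pair_cells k T. w k d * w (Suc k) (up d)) =
        (\<Prod>d | d \<in> pair_cells k T \<and> up d \<in> pair_cells k T. w' k d * w' (Suc k) (up d))"
      using column by (intro prod.cong) (auto simp: pair_cells_def)
    ultimately show ?thesis
      by (simp add: fiber_sum[OF T k] prod_fixed_cells[OF T])
  qed
  then show ?thesis
    unfolding sum.image_gen[OF finite_fillings, of _ "collapse k"]
    by (intro sum.cong[OF refl, of "collapse k ` fillings"]) auto
qed

end

section \<open>The birational R-matrix\<close>

text \<open>Both terms on the left are sums of the same mixed products \<open>P t\<close>, with
  \<open>t\<close> shifted by one, so the difference telescopes to the two pure products over a full
  period.\<close>

lemma kappa_shift_diff:
  fixes x y :: "int \<Rightarrow> 'a::comm_ring_1"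
  assumes n: "n \<ge> 1" and "\<And>i. x (i + int n) = x i"
  shows "y (i + 1) * kappa n (i + 1) x y - x i * kappa n i x y =
    (\<Prod>u = 1..n. y (i + int u)) - (\<Prod>u = 1..n. x (i + int u))"
proof -
  define P where "P t = (\<Prod>u = 1..t. y (i + int u)) * (\<Prod>u = t + 1..n. x (i + int u))" for t
  have "x i * kappa n i x y = (\<Sum>t = 0..n - 1. P t)"
    unfolding kappa_def sum_distrib_left
  proof (rule sum.cong[OF refl])
    fix t assume t: "t \<in> {0..n - 1}"
    \<comment> \<open>By periodicity the extra factor \<open>x i\<close> is
      \<open>x (i + int n)\<close>, the last factor of the full product.\<close>
    have "(\<Prod>u = t + 1..n. x (i + int u)) = (\<Prod>u = t + 1..n - 1. x (i + int u)) * x (i + int n)"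
      using prod.nat_ivl_Suc'[of "t + 1" "n - 1" "\<lambda>u. x (i + int u)"] n t by (simp add: mult.commute)
    then show "x i * ((\<Prod>u = 1..t. y (i + int u)) * (\<Prod>u = t + 1..n - 1. x (i + int u))) = P t"
      by (simp add: P_def assms(2) mult_ac)
  qed
  moreover have "y (i + 1) * kappa n (i + 1) x y = (\<Sum>t = 0..n - 1. P (Suc t))"
    unfolding kappa_def sum_distrib_left
  proof (rule sum.cong[OF refl])
    fix t assume t: "t \<in> {0..n - 1}"
    have "(\<Prod>u = 1..Suc t. y (i + int u)) = y (i + 1) * (\<Prod>u = 2..Suc t. y (i + int u))"
      by (subst prod.atLeast_Suc_atMost) (auto simp: numeral_2_eq_2)
    also have "(\<Prod>u = 2..Suc t. y (i + int u)) = (\<Prod>u = 1..t. y (i + 1 + int u))"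
      using prod.shift_bounds_cl_Suc_ivl[of "\<lambda>u. y (i + int u)" 1 t]
      by (simp add: numeral_2_eq_2 add_ac)
    finally have *: "(\<Prod>u = 1..Suc t. y (i + int u)) = y (i + 1) * (\<Prod>u = 1..t. y (i + 1 + int u))" .
    have "(\<Prod>u = Suc t + 1..n. x (i + int u)) = (\<Prod>u = t + 1..n - 1. x (i + 1 + int u))"
      using prod.shift_bounds_cl_Suc_ivl[of "\<lambda>u. x (i + int u)" "t + 1" "n - 1"] n
      by (simp add: add_ac)
    with * show "y (i + 1) * ((\<Prod>u = 1..t. y (i + 1 + int u)) * (\<Prod>u = t + 1..n - 1. x (i + 1 + int u)))
        = P (Suc t)"
      unfolding P_def by (simp only: mult_ac)
  qed
  moreover have "(\<Sum>t = 0..n - 1. P (Suc t)) - (\<Sum>t = 0..n - 1. P t) = P n - P 0"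
    using n sum_Suc_diff[of 0 "n - 1" P] by (simp add: sum_subtractf)
  ultimately show ?thesis by (simp add: P_def)
qed

text \<open>Shows that the right-hand side of \<open>kappa_shift_diff\<close> does not depend on
  \<open>i\<close>.\<close>

lemma prod_periodic:
  fixes f :: "int \<Rightarrow> 'a::comm_monoid_mult"
  assumes n: "n \<ge> 1" and "\<And>i. f (i + int n) = f i"
  shows "(\<Prod>u = 1..n. f (i - 1 + int u)) = (\<Prod>u = 1..n. f (i + int u))"
proof -
  have "(\<Prod>u = 1..n. f (i - 1 + int u)) = (\<Prod>u = 0..n - 1. f (i + int u))"
    using prod.shift_bounds_cl_Suc_ivl[of "\<lambda>u. f (i - 1 + int u)" 0 "n - 1"] n by simp
  also have "\<dots> = f i * (\<Prod>u = 1..n - 1. f (i + int u))"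
    by (subst prod.atLeast_Suc_atMost) auto
  also have "\<dots> = (\<Prod>u = 1..n. f (i + int u))"
    using prod.nat_ivl_Suc'[of 1 "n - 1" "\<lambda>u. f (i + int u)"] n assms(2) by simp
  finally show ?thesis .
qed

text \<open>After multiplication by \<open>kappa n i x y\<close>, the claim says that the difference
  in \<open>kappa_shift_diff\<close> agrees at \<open>i\<close> and \<open>i - 1\<close>.\<close>

lemma birational_R_add:
  fixes x y :: "int \<Rightarrow> 'a::field"
  assumes n: "n \<ge> 1" and x: "\<And>i. x (i + int n) = x i" and y: "\<And>i. y (i + int n) = y i"
    and "kappa n i x y \<noteq> 0"
  shows "birational_R_fst n x y i + birational_R_snd n x y i = x i + y i"
proof -
  have "y (i + 1) * kappa n (i + 1) x y - x i * kappa n i x y =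
      y i * kappa n i x y - x (i - 1) * kappa n (i - 1) x y"
    using kappa_shift_diff[of n x y i] kappa_shift_diff[of n x y "i - 1"]
      prod_periodic[of n x i] prod_periodic[of n y i] assms by simp
  then show ?thesis
    using assms(4) by (simp add: birational_R_fst_def birational_R_snd_def divide_simps)
      (simp add: algebra_simps)
qed

lemma birational_R_mult:
  fixes x y :: "int \<Rightarrow> 'a::field"
  assumes "kappa n i x y \<noteq> 0" "kappa n (i + 1) x y \<noteq> 0"
  shows "birational_R_fst n x y i * birational_R_snd n x y (i + 1) = x i * y (i + 1)"
  using assms by (simp add: birational_R_fst_def birational_R_snd_def)

text \<open>Substitution evaluates the images at representatives in \<open>{0..<int n}\<close>,
  while the identities for R hold at arbitrary integers; this passes between the two.\<close>

lemma birational_R_mod: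
  assumes "\<And>i. x (i mod int n) = x i" "\<And>i. y (i mod int n) = y i"
  shows "birational_R_fst n x y (i mod int n) = birational_R_fst n x y i"
    and "birational_R_snd n x y (i mod int n) = birational_R_snd n x y i"
proof -
  have shift: "z (i mod int n + j) = z (i + j)" if "\<And>i. z (i mod int n) = z i" for z :: "int \<Rightarrow> 'a" and j
    by (metis that mod_add_left_eq)
  have kappa: "kappa n (i mod int n + j) x y = kappa n (i + j) x y" for j
    unfolding kappa_def add.assoc by (simp add: shift assms)
  show "birational_R_fst n x y (i mod int n) = birational_R_fst n x y i"
    "birational_R_snd n x y (i mod int n) = birational_R_snd n x y i"
    using kappa[of 0] kappa[of 1] kappa[of "-1"] shift[of y 1] shift[of x "-1"] assms
    by (simp_all add: birational_R_fst_def birational_R_snd_def)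
qed

section \<open>Polynomials and substitution\<close>

lemma to_ratfun_sum: "to_ratfun (sum f A) = (\<Sum>a\<in>A. to_ratfun (f a))"
  by (induction A rule: infinite_finite_induct) auto

lemma to_ratfun_prod: "to_ratfun (prod f A) = (\<Prod>a\<in>A. to_ratfun (f a))"
  by (induction A rule: infinite_finite_induct) auto

lemma subst_poly_sum: "subst_poly \<sigma> (sum f A) = (\<Sum>a\<in>A. subst_poly \<sigma> (f a))"
  by (induction A rule: infinite_finite_induct) (auto simp: subst_poly_add)

lemma subst_poly_prod: "subst_poly \<sigma> (prod f A) = (\<Prod>a\<in>A. subst_poly \<sigma> (f a))"
  by (induction A rule: infinite_finite_induct) (auto simp: subst_poly_mult)

lemma subst_poly_var: "subst_poly \<sigma> (var n j i) = \<sigma> (j, i mod int n)"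
  by (simp add: var_def subst_poly_single subst_monom_def)

lemma to_ratfun_eq_0_iff: "to_ratfun f = 0 \<longleftrightarrow> f = 0"
  by (simp add: to_ratfun_def Zero_fract_def eq_fract)

lemma var_mod: "var n j (i mod int n) = var n j i"
  by (simp add: var_def)

lemma var_add: "var n j (i + int n) = var n j i"
  by (simp add: var_def)

text \<open>Setting all variables to 1 turns each of the \<open>n\<close> summands into 1, and
  \<open>n\<close> is nonzero in characteristic 0.\<close>

lemma kappa_var_nonzero:
  assumes "n \<ge> 1"
  shows "kappa n r (\<lambda>i. to_ratfun (var n j i)) (\<lambda>i. to_ratfun (var n l i)) \<noteq> 0"
proof
  let ?K = "kappa n r (var n j) (var n l)"
  assume "kappa n r (\<lambda>i. to_ratfun (var n j i)) (\<lambda>i. to_ratfun (var n l i)) = 0"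
  then have "to_ratfun ?K = 0"
    by (simp add: kappa_def to_ratfun_sum to_ratfun_prod)
  then have "?K = 0" by (simp add: to_ratfun_eq_0_iff)
  then have "subst_poly (\<lambda>_. 1) ?K = 0" by simp
  then have "(of_nat n :: ratfun_x) = 0"
    using assms by (simp add: kappa_def subst_poly_sum subst_poly_mult subst_poly_prod subst_poly_var)
  then have "to_ratfun (of_nat n) = 0"
    by (simp add: to_ratfun_def of_nat_fract)
  then have "(of_nat n :: poly_x) = 0" by (simp add: to_ratfun_eq_0_iff)
  then have "Poly_Mapping.lookup (of_nat n :: poly_x) 0 = 0" by simp
  then show False using assms by (simp add: lookup_of_nat)
qed

lemma R_images_other: "j \<noteq> k \<Longrightarrow> j \<noteq> Suc k \<Longrightarrow> R_images n k (j, i) = to_ratfun (var n j i)"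
  by (simp add: R_images_def Let_def)

lemma R_images_mod: "R_images n k (j, i mod int n) = R_images n k (j, i)"
  by (simp add: R_images_def Let_def birational_R_mod var_mod)

lemma R_images_add:
  assumes "n \<ge> 1"
  shows "R_images n k (k, i) + R_images n k (Suc k, i) = to_ratfun (var n k i) + to_ratfun (var n (Suc k) i)"
  using assms by (simp add: R_images_def Let_def birational_R_add var_add kappa_var_nonzero)

lemma R_images_mult:
  assumes "n \<ge> 1"
  shows "R_images n k (k, i) * R_images n k (Suc k, i + 1) =
    to_ratfun (var n k i) * to_ratfun (var n (Suc k) (i + 1))"
  using assms by (simp add: R_images_def Let_def birational_R_mult kappa_var_nonzero)

section \<open>Closure properties of the polynomial ring\<close>

lemma poly_ring_0: "0 \<in> poly_ring n m" and poly_ring_1: "1 \<in> poly_ring n m"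
  by (auto simp: poly_ring_def)

lemma poly_ring_add: "f \<in> poly_ring n m \<Longrightarrow> g \<in> poly_ring n m \<Longrightarrow> f + g \<in> poly_ring n m"
  using Poly_Mapping.keys_add[of f g] by (auto simp: poly_ring_def)

lemma poly_ring_mult:
  assumes "f \<in> poly_ring n m" "g \<in> poly_ring n m"
  shows "f * g \<in> poly_ring n m"
  unfolding poly_ring_def
proof (intro CollectI ballI)
  fix \<mu> assume "\<mu> \<in> Poly_Mapping.keys (f * g)"
  then obtain a b where "\<mu> = a + b" "a \<in> Poly_Mapping.keys f" "b \<in> Poly_Mapping.keys g"
    using keys_mult[of f g] by blast
  then show "Poly_Mapping.keys \<mu> \<subseteq> {1..m} \<times> {0..<int n}"
    using Poly_Mapping.keys_add[of a b] assms unfolding poly_ring_def by blast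
qed

lemma poly_ring_sum: "(\<And>a. a \<in> A \<Longrightarrow> f a \<in> poly_ring n m) \<Longrightarrow> sum f A \<in> poly_ring n m"
  by (induction A rule: infinite_finite_induct) (auto simp: poly_ring_0 poly_ring_add)

lemma poly_ring_prod: "(\<And>a. a \<in> A \<Longrightarrow> f a \<in> poly_ring n m) \<Longrightarrow> prod f A \<in> poly_ring n m"
  by (induction A rule: infinite_finite_induct) (auto simp: poly_ring_1 poly_ring_mult)

lemma var_in_poly_ring: "n \<ge> 1 \<Longrightarrow> j \<in> {1..m} \<Longrightarrow> var n j i \<in> poly_ring n m"
  by (simp add: var_def poly_ring_def)

section \<open>The cylinder\<close>

text \<open>Translating a whole set of points needs no choice of representative and is injective on
  the entire type, as \<open>cell_grid\<close> demands.\<close>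

definition box_right :: "(int \<times> int) set \<Rightarrow> (int \<times> int) set" where
  "box_right d = (\<lambda>(a, b). (a + 1, b)) ` d"

definition box_up :: "(int \<times> int) set \<Rightarrow> (int \<times> int) set" where
  "box_up d = (\<lambda>(a, b). (a, b - 1)) ` d"

lemma box_eq: "box n s a b = range (\<lambda>k. (a + k * (int n - int s), b + k * int s))"
  by (auto simp: box_def shift_rel_def)

lemma box_right_box: "box_right (box n s a b) = box n s (a + 1) b"
  by (simp add: box_eq box_right_def image_image add_ac)

lemma box_up_box: "box_up (box n s a b) = box n s a (b - 1)"
  by (simp add: box_eq box_up_def image_image algebra_simps)

lemma cylinder_eq_box: "d \<in> cylinder n s \<longleftrightarrow> (\<exists>a b. d = box n s a b)"
  by (auto simp: cylinder_def box_def quotient_def)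

lemma inj_box_right: "inj box_right" and inj_box_up: "inj box_up"
  by (rule injI; simp add: box_right_def box_up_def inj_image_eq_iff inj_def)+

text \<open>A multiple \<open>k\<close> of the period moves the second coordinate by
  \<open>k * int s\<close>, so two points of one row are identified only for
  \<open>k = 0\<close>.\<close>

lemma inj_box_row:
  assumes "s \<ge> 1"
  shows "inj (\<lambda>a. box n s a b)"
proof (rule injI)
  fix a a' assume "box n s a b = box n s a' b"
  moreover have "(a, b) \<in> box n s a b" unfolding box_eq by (rule range_eqI[of _ _ 0]) simp
  ultimately have "(a, b) \<in> box n s a' b" by simp
  then obtain k where "a = a' + k * (int n - int s)" "b = b + k * int s"
    unfolding box_eq by blast
  then show "a = a'" using assms by auto
qed

text \<open>A nonempty set closed under \<open>box_right\<close> would contain infinitely many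
  distinct boxes of one row.\<close>

lemma cylinder_acyclic:
  assumes s: "s \<ge> 1" and H: "finite H" "H \<subseteq> cylinder n s" "H \<noteq> {}"
  shows "\<exists>d\<in>H. box_right d \<notin> H"
proof (rule ccontr)
  assume "\<not> ?thesis"
  then have step: "box_right d \<in> H" if "d \<in> H" for d using that by blast
  obtain d where "d \<in> H" using H(3) by blast
  then obtain a b where "box n s a b \<in> H" using H(2) by (auto simp: subset_iff cylinder_eq_box)
  then have "box n s (a + int j) b \<in> H" for j
  proof (induction j)
    case (Suc j)
    then show ?case using step[of "box n s (a + int j) b"] by (simp add: box_right_box add_ac)
  qed simp
  then have "finite (range (\<lambda>j. box n s (a + int j) b))"
    by (intro finite_subset[OF _ H(1)] image_subsetI)
  moreover have "inj (\<lambda>j. box n s (a + int j) b)"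
    using inj_compose[OF inj_box_row[OF s, of n b], of "\<lambda>j. a + int j"]
    by (simp add: inj_def comp_def)
  ultimately have "finite (UNIV :: nat set)" by (rule finite_imageD)
  then show False by simp
qed

lemma cylindric_skew_shape_cell_grid:
  assumes s: "s \<ge> 1" and D: "cylindric_skew_shape n s D"
  shows "cell_grid D box_right box_up"
proof
  have DC: "D \<subseteq> cylinder n s" and fin: "finite D" using D by (auto simp: cylindric_skew_shape_def)
  show "finite D" by (rule fin)
  show "inj box_right" "inj box_up" by (rule inj_box_right inj_box_up)+
  show "box_up (box_right d) = box_right (box_up d)" for d
    by (simp add: box_up_def box_right_def image_image case_prod_beta)
  show "\<exists>d\<in>H. box_right d \<notin> H" if "H \<subseteq> D" "H \<noteq> {}" for H
    by (rule cylinder_acyclic[OF s finite_subset[OF that(1) fin] order_trans[OF that(1) DC] that(2)])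
  fix d assume d: "d \<in> D" "box_up (box_right d) \<in> D"
  have "d \<in> cylinder n s" using d(1) DC by blast
  then obtain a b where ab: "d = box n s a b" unfolding cylinder_eq_box by blast
  have q: "box_up (box_right d) = box n s (a + 1) (b - 1)" by (simp add: ab box_right_box box_up_box)
  have less: "(box n s u v, box n s (u + 1) v) \<in> cyl_less n s"
    "(box n s u v, box n s u (v - 1)) \<in> cyl_less n s" for u v
    unfolding cyl_less_def by (auto intro!: r_into_trancl)
  have between: "e \<in> D" if "e \<in> cylinder n s" "(d, e) \<in> cyl_less n s"
      "(e, box n s (a + 1) (b - 1)) \<in> cyl_less n s" for e
  proof -
    have "\<forall>p\<in>D. \<forall>q\<in>D. \<forall>e\<in>cylinder n s. (p, e) \<in> cyl_less n s \<and> (e, q) \<in> cyl_less n s \<longrightarrow> e \<in> D"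
      using D unfolding cylindric_skew_shape_def by (elim conjE)
    from this[rule_format, OF d(1) d(2) that(1)] show ?thesis using that(2,3) q by simp
  qed
  \<comment> \<open>The two other corners of the unit square lie between \<open>d\<close> and
    \<open>box_up (box_right d)\<close> in the cylinder order.\<close>
  have "box n s u v \<in> cylinder n s" for u v by (auto simp: cylinder_eq_box)
  then have "box n s a (b - 1) \<in> D" "box n s (a + 1) b \<in> D"
    using between less ab by simp_all
  then show "box_up d \<in> D \<and> box_right d \<in> D"
    by (simp add: ab box_right_box box_up_box)
qed

lemma tableaux_eq_fillings:
  assumes s: "s \<ge> 1" and D: "cylindric_skew_shape n s D"
  shows "tableaux n s m D = cell_grid.fillings D box_right box_up m"
proof -
  interpret cell_grid D box_right box_up m
    by (rule cylindric_skew_shape_cell_grid[OF assms])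
  have "D \<subseteq> cylinder n s" using D by (auto simp: cylindric_skew_shape_def)
  then have all: "(\<forall>d. d \<in> D \<and> P d \<longrightarrow> Q d) \<longleftrightarrow>
      (\<forall>a b. box n s a b \<in> D \<and> P (box n s a b) \<longrightarrow> Q (box n s a b))" for P Q
    unfolding cylinder_eq_box subset_iff by metis
  show ?thesis
    unfolding tableaux_def fillings_def all box_right_box box_up_box ..
qed

section \<open>Invariance under the generators and under all their products\<close>

text \<open>The generator replaces the weights \<open>w'\<close> by \<open>w\<close> in the same sum
  over tableaux, so \<open>sum_fillings_cong\<close> applies once R is known to preserve the sums
  and products.\<close>

lemma R_act_cylindric_loop_schur:
  assumes n: "n \<ge> 1" and s: "s \<ge> 1" and D: "cylindric_skew_shape n s D"
    and k: "1 \<le> k" "Suc k \<le> m"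
  shows "R_act n k (to_ratfun (cylindric_loop_schur n s m r D)) =
    to_ratfun (cylindric_loop_schur n s m r D)"
proof -
  interpret cell_grid D box_right box_up m
    by (rule cylindric_skew_shape_cell_grid[OF s D])
  have DC: "D \<subseteq> cylinder n s" using D by (auto simp: cylindric_skew_shape_def)
  define w where "w j d = R_images n k (j, content_mod n d + r)" for j d
  define w' where "w' j d = to_ratfun (var n j (content_mod n d + r))" for j d
  have shift: "w j (box n s a b) = R_images n k (j, - a - b + r)"
    "w' j (box n s a b) = to_ratfun (var n j (- a - b + r))" for j a b
    unfolding w_def w'_def content_mod_box
    by (metis R_images_mod var_mod mod_add_left_eq)+
  \<comment> \<open>A step to the right lowers the content by 1 and a step up raises it by 1. Hence
    rows and columns both lead to the product of \<open>k\<close> at content \<open>i\<close> with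
    \<open>Suc k\<close> at content \<open>i + 1\<close>.\<close>
  have mult: "w k (box n s a b) * w (Suc k) (box n s c d) = w' k (box n s a b) * w' (Suc k) (box n s c d)"
    if "- c - d = - a - b + 1" for a b c d
  proof -
    have "- c - d + r = - a - b + r + 1" using that by simp
    then show ?thesis unfolding shift by (simp only: R_images_mult[OF n])
  qed
  have "R_act n k (to_ratfun (cylindric_loop_schur n s m r D)) = (\<Sum>T\<in>fillings. \<Prod>d\<in>D. w (T d) d)"
    by (simp add: R_act_def subst_ratfun_to_ratfun cylindric_loop_schur_def subst_poly_sum
        subst_poly_prod subst_poly_var R_images_mod w_def tableaux_eq_fillings[OF s D])
  also have "\<dots> = (\<Sum>T\<in>fillings. \<Prod>d\<in>D. w' (T d) d)"
  proof (rule sum_fillings_cong[OF k])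
    fix d assume "d \<in> D"
    then have "d \<in> cylinder n s" using DC by blast
    then obtain a b where ab: "d = box n s a b" unfolding cylinder_eq_box by blast
    show "w k d + w (Suc k) d = w' k d + w' (Suc k) d"
      unfolding w_def w'_def by (rule R_images_add[OF n])
    show "w k (box_right d) * w (Suc k) d = w' k (box_right d) * w' (Suc k) d"
      "w k d * w (Suc k) (box_up d) = w' k d * w' (Suc k) (box_up d)"
      unfolding ab box_right_box box_up_box by (rule mult; simp)+
  qed (simp add: w_def w'_def R_images_other)
  also have "\<dots> = to_ratfun (cylindric_loop_schur n s m r D)"
    by (simp add: cylindric_loop_schur_def to_ratfun_sum to_ratfun_prod w'_def
        tableaux_eq_fillings[OF s D])
  finally show ?thesis .
qed

lemma cylindric_loop_schur_in_poly_ring: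
  assumes "n \<ge> 1"
  shows "cylindric_loop_schur n s m r D \<in> poly_ring n m"
  unfolding cylindric_loop_schur_def
  by (intro poly_ring_sum poly_ring_prod var_in_poly_ring assms) (auto simp: tableaux_def)

theorem proposition4p9:
  fixes n m s :: nat and r :: int and D :: "(int \<times> int) set set"
  assumes "n \<ge> 2" and "m \<ge> 1" and "1 \<le> s" and "s \<le> n - 1"
    and "cylindric_skew_shape n s D"
  shows "cylindric_loop_schur n s m r D \<in> invariant_ring n m"
  unfolding invariant_ring_def
proof (intro CollectI conjI ballI)
  let ?f = "cylindric_loop_schur n s m r D"
  show "?f \<in> poly_ring n m" using assms by (intro cylindric_loop_schur_in_poly_ring) simp
  fix g assume "g \<in> R_group n m"
  then show "g (to_ratfun ?f) = to_ratfun ?f"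
  proof induction
    case (step g k)
    \<comment> \<open>The bounds \<open>1 \<le> k\<close> and \<open>k \<le> m - 1\<close> give
      \<open>Suc k \<le> m\<close>, also with truncated subtraction.\<close>
    then show ?case using R_act_cylindric_loop_schur[of n s D k m r] assms by simp
  qed simp
qed

end
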